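(* Let $d\in\mathbb{N}$ and suppose that $\mathcal{L} \subseteq \mathbb{R}^{2d}$ satisfies one of the following two conditions: (1) $\mathcal{L} = S(\mathbb{R}^d \times \Lambda) = \{ S(x,\lambda) : x \in \mathbb{R}^d, \lambda \in \Lambda \}$ for some symplectic matrix $S\in \mathrm{Sp}_{2d}(\mathbb{R})$ and some lattice $\Lambda \subseteq \mathbb{R}^d$; (2) $\mathcal{L} = L\mathbb{Z}^{2d}$ for some $L \in \mathrm{GL}_{2d}(\mathbb{R})$ which factors as $L=ST$ with $S\in \mathrm{Sp}_{2d}(\mathbb{R})$ and $T = \begin{pmatrix} A & 0 \\ 0 & B \end{pmatrix}$ with $A,B \in \mathrm{GL}_d(\mathbb{R})$. Then for every window function $g \in L^2(\mathbb{R}^d)$ there exist $f_1,f_2 \in L^2(\mathbb{R}^d)$ such that $|V_g f_1(z)| = |V_g f_2(z)|$ for all $z \in \mathcal{L}$, and there is no $\nu\in\mathbb{C}$ with $|\nu|=1$ and $f_1=\nu f_2$.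
   Context: For $f,g\in L^2(\mathbb{R}^d)$ the short-time Fourier transform is $V_gf(x,\omega)=\int_{\mathbb{R}^d} f(t)\overline{g(t-x)}e^{-2\pi i \omega\cdot t}\,dt$, $x,\omega\in\mathbb{R}^d$. A lattice in $\mathbb{R}^n$ is a set $M\mathbb{Z}^n$ with $M\in\mathrm{GL}_n(\mathbb{R})$. With $\mathcal{J}=\begin{pmatrix}0&-I_d\\ I_d&0\end{pmatrix}$, $\mathrm{Sp}_{2d}(\mathbb{R})=\{S\in\mathrm{GL}_{2d}(\mathbb{R}): S^T\mathcal{J}S=\mathcal{J}\}$. *)

theory Defs
  imports "HOL-Analysis.Analysis"
begin

text \<open>Vectors in R^d are modelled as real^'d for a finite index type 'd
  (d = CARD('d)); vectors in R^(2d) as real^('d + 'd), the first block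
  (indices Inl i) being the first d coordinates and the second block
  (indices Inr i) the last d coordinates.\<close>

definition join_vec :: "real^'d::finite \<Rightarrow> real^'d \<Rightarrow> real^('d + 'd)" where
  "join_vec x y = (\<chi> i. case i of Inl j \<Rightarrow> x $ j | Inr j \<Rightarrow> y $ j)"

definition fst_vec :: "real^('d::finite + 'd) \<Rightarrow> real^'d" where
  "fst_vec z = (\<chi> j. z $ Inl j)"

definition snd_vec :: "real^('d::finite + 'd) \<Rightarrow> real^'d" where
  "snd_vec z = (\<chi> j. z $ Inr j)"

definition lattice_of :: "real^'n^'n \<Rightarrow> (real^'n) set" where
  "lattice_of M = {M *v k | k. \<forall>i. k $ i \<in> \<int>}"

definition is_lattice :: "(real^'n) set \<Rightarrow> bool" where
  "is_lattice \<Lambda> \<longleftrightarrow> (\<exists>M. invertible M \<and> \<Lambda> = lattice_of M)"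

definition J_mat :: "real^('d::finite + 'd)^('d + 'd)" where
  "J_mat = (\<chi> i j. case (i, j) of
      (Inl a, Inr b) \<Rightarrow> (if a = b then -1 else 0)
    | (Inr a, Inl b) \<Rightarrow> (if a = b then 1 else 0)
    | _ \<Rightarrow> 0)"

definition symplectic :: "real^('d::finite + 'd)^('d + 'd) \<Rightarrow> bool" where
  "symplectic S \<longleftrightarrow> invertible S \<and> transpose S ** J_mat ** S = J_mat"

definition block_diag :: "real^'d::finite^'d \<Rightarrow> real^'d^'d \<Rightarrow> real^('d::finite + 'd)^('d + 'd)" where
  "block_diag A B = (\<chi> i j. case (i, j) of
      (Inl a, Inl b) \<Rightarrow> A $ a $ b
    | (Inr a, Inr b) \<Rightarrow> B $ a $ b
    | _ \<Rightarrow> 0)"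

text \<open>Square-integrable functions (representatives of L^2(R^d)).\<close>
definition square_integrable :: "(real^'d::finite \<Rightarrow> complex) \<Rightarrow> bool" where
  "square_integrable f \<longleftrightarrow> f \<in> borel_measurable lborel \<and>
     integrable lborel (\<lambda>t. (cmod (f t))\<^sup>2)"

definition stft :: "(real^'d::finite \<Rightarrow> complex) \<Rightarrow> (real^'d \<Rightarrow> complex) \<Rightarrow> real^'d \<Rightarrow> real^'d \<Rightarrow> complex" where
  "stft g f x \<omega> = (LINT t|lborel. f t * cnj (g (t - x)) * cis (- 2 * pi * (\<omega> \<bullet> t)))"

end

theory Submission
  imports Defs
begin

text \<open>
  Write \<open>R g(t) = g(-t)\<close> and let \<open>\<rho>(a,b) h(t) = exp(2 \<pi> i b\<cdot>t - \<pi> i a\<cdot>b) h(t - a)\<close> be the symmetric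
  time-frequency shifts. The transform of \<open>R g\<close> with window \<open>g\<close> is a Wigner distribution,
  hence real up to the phase \<open>exp(-\<pi> i \<omega>\<cdot>x)\<close>, and by covariance the transform of \<open>\<rho>(a,b) (R g)\<close>
  at \<open>(x,\<omega>)\<close> is real up to the same phase times \<open>exp(\<pi> i (b\<cdot>x - a\<cdot>\<omega>))\<close>. If the linear functional
  \<open>(x,\<omega>) \<mapsto> b\<cdot>x - a\<cdot>\<omega>\<close> is integer-valued on the sampling set, the second phase is \<open>\<plusminus>1\<close>, so
  \<open>R g + i \<rho>(a,b) (R g)\<close> and \<open>R g - i \<rho>(a,b) (R g)\<close> have transforms of the same modulus there.
  Such a nonzero functional exists in both cases, and the two functions are not proportional
  because \<open>\<rho>(a,b)\<close> has no eigenfunctions in \<open>L\<^sup>2\<close> when \<open>(a,b) \<noteq> 0\<close>.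
\<close>

section \<open>Reflections and translations of Lebesgue measure\<close>

lemma lborel_distr_reflect:
  fixes c :: "'a::euclidean_space"
  shows "distr lborel borel (\<lambda>t. c - t) = lborel"
  using lborel_affine[of "-1" c] by (simp add: density_1)

lemma integral_lborel_reflect:
  fixes f :: "'a::euclidean_space \<Rightarrow> 'b::{banach, second_countable_topology}"
  assumes "f \<in> borel_measurable borel"
  shows "(LINT t|lborel. f (c - t)) = (LINT t|lborel. f t)"
  by (subst (2) lborel_distr_reflect[of c, symmetric]) (use assms in \<open>simp add: integral_distr\<close>)

lemma integrable_lborel_reflect:
  fixes f :: "'a::euclidean_space \<Rightarrow> 'b::{banach, second_countable_topology}"
  assumes "integrable lborel f"
  shows "integrable lborel (\<lambda>t. f (c - t))"
proof -
  have "f \<in> borel_measurable borel"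
    using assms by (auto dest: borel_measurable_integrable)
  moreover have "integrable (distr lborel borel (\<lambda>t. c - t)) f"
    using assms by (simp add: lborel_distr_reflect)
  ultimately show ?thesis
    by (subst (asm) integrable_distr_eq) auto
qed

lemma AE_eq_zero_lborel_reflect:
  fixes f :: "'a::euclidean_space \<Rightarrow> complex"
  assumes "f \<in> borel_measurable borel"
  shows "(AE t in lborel. f (c - t) = 0) \<longleftrightarrow> (AE t in lborel. f t = 0)"
proof -
  have "{t. f t = 0} = f -` {0}"
    by auto
  then have "{t. f t = 0} \<in> sets borel"
    using measurable_sets_borel[OF assms, of "{0}"] by simp
  then have "(AE t in distr lborel borel (\<lambda>t. c - t). f t = 0) \<longleftrightarrow> (AE t in lborel. f (c - t) = 0)"
    by (subst AE_distr_iff) auto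
  then show ?thesis
    unfolding lborel_distr_reflect by simp
qed

section \<open>Square-integrable functions\<close>

lemma square_integrable_measurable [measurable_dest]:
  "square_integrable f \<Longrightarrow> f \<in> borel_measurable borel"
  by (simp add: square_integrable_def)

lemma square_integrable_reflect:
  assumes "square_integrable f"
  shows "square_integrable (\<lambda>t. f (c - t))"
proof -
  have [measurable]: "f \<in> borel_measurable borel"
    using assms by (rule square_integrable_measurable)
  show ?thesis
    using assms integrable_lborel_reflect[of "\<lambda>t. (cmod (f t))\<^sup>2" c]
    by (simp add: square_integrable_def)
qed

text \<open>A translation is a composition of two reflections:
  \<open>t - c = -c - (0 - t)\<close>.\<close>

lemma square_integrable_translate:
  assumes "square_integrable f"
  shows "square_integrable (\<lambda>t. f (t - c))"
  using square_integrable_reflect[OF square_integrable_reflect[OF assms, of "- c"], of 0] by simp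

lemma square_integrable_phase:
  assumes "square_integrable f"
    and [measurable]: "p \<in> borel_measurable borel" and "\<And>t. cmod (p t) = 1"
  shows "square_integrable (\<lambda>t. p t * f t)"
proof -
  have [measurable]: "f \<in> borel_measurable borel"
    using assms(1) by (rule square_integrable_measurable)
  show ?thesis
    using assms(1,3) by (simp add: square_integrable_def norm_mult)
qed

lemma square_integrable_add:
  assumes "square_integrable f" "square_integrable h"
  shows "square_integrable (\<lambda>t. f t + h t)"
proof -
  have [measurable]: "f \<in> borel_measurable borel" "h \<in> borel_measurable borel"
    using assms by (auto intro: square_integrable_measurable)
  have "(cmod (f t + h t))\<^sup>2 \<le> 2 * (cmod (f t))\<^sup>2 + 2 * (cmod (h t))\<^sup>2" for t
  proof -
    have "(cmod (f t + h t))\<^sup>2 \<le> (cmod (f t) + cmod (h t))\<^sup>2"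
      by (intro power_mono norm_triangle_ineq) auto
    also have "\<dots> \<le> 2 * (cmod (f t))\<^sup>2 + 2 * (cmod (h t))\<^sup>2"
      using sum_squares_bound[of "cmod (f t)" "cmod (h t)"] by (simp add: power2_sum)
    finally show ?thesis .
  qed
  then have bound: "AE t in lborel. norm ((cmod (f t + h t))\<^sup>2)
      \<le> norm (2 * (cmod (f t))\<^sup>2 + 2 * (cmod (h t))\<^sup>2)"
    by simp
  have "integrable lborel (\<lambda>t. 2 * (cmod (f t))\<^sup>2 + 2 * (cmod (h t))\<^sup>2)"
    using assms by (simp add: square_integrable_def)
  then have "integrable lborel (\<lambda>t. (cmod (f t + h t))\<^sup>2)"
    by (rule Bochner_Integration.integrable_bound[OF _ _ bound]) measurable
  then show ?thesis
    by (simp add: square_integrable_def)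
qed

text \<open>The product is dominated through \<open>2 |f| |h| \<le> |f|^2 + |h|^2\<close>.\<close>

lemma integrable_mult_square_integrable:
  assumes "square_integrable f" "square_integrable h"
  shows "integrable lborel (\<lambda>t. f t * h t)"
proof (rule Bochner_Integration.integrable_bound)
  show "integrable lborel (\<lambda>t. (cmod (f t))\<^sup>2 + (cmod (h t))\<^sup>2)"
    using assms by (auto simp: square_integrable_def)
  show "(\<lambda>t. f t * h t) \<in> borel_measurable lborel"
    using assms by (auto simp: square_integrable_def)
  have "cmod (f t) * cmod (h t) \<le> (cmod (f t))\<^sup>2 + (cmod (h t))\<^sup>2" for t
  proof -
    have "0 \<le> cmod (f t) * cmod (h t)"
      by simp
    then show ?thesis
      using sum_squares_bound[of "cmod (f t)" "cmod (h t)"] by linarith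
  qed
  then show "AE t in lborel. norm (f t * h t) \<le> norm ((cmod (f t))\<^sup>2 + (cmod (h t))\<^sup>2)"
    by (auto simp: norm_mult)
qed

lemma square_integrable_cnj:
  "square_integrable f \<Longrightarrow> square_integrable (\<lambda>t. cnj (f t))"
proof -
  assume *: "square_integrable f"
  then have "f \<in> borel_measurable borel"
    by (rule square_integrable_measurable)
  then have "(\<lambda>t. cnj (f t)) \<in> borel_measurable borel"
    by (rule borel_measurable_continuous_on[rotated]) (auto intro: continuous_intros)
  with * show ?thesis
    by (simp add: square_integrable_def)
qed

text \<open>Guarantees that \<open>stft\<close> is never the default value 0 of a non-integrable
  integrand, so that it may be split linearly. The exponential is unimodular and is absorbed into
  \<open>f\<close>.\<close>

lemma stft_integrable:
  fixes f g :: "real^'d::finite \<Rightarrow> complex"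
  assumes "square_integrable f" "square_integrable g"
  shows "integrable lborel (\<lambda>t. f t * cnj (g (t - x)) * cis (- 2 * pi * (\<omega> \<bullet> t)))"
proof -
  have "(\<lambda>t::real^'d. cis (- 2 * pi * (\<omega> \<bullet> t))) \<in> borel_measurable borel"
    by (intro borel_measurable_continuous_onI continuous_intros)
  then have "square_integrable (\<lambda>t. cis (- 2 * pi * (\<omega> \<bullet> t)) * f t)"
    using assms by (intro square_integrable_phase) auto
  moreover have "square_integrable (\<lambda>t. cnj (g (t - x)))"
    using assms by (intro square_integrable_cnj square_integrable_translate)
  ultimately show ?thesis
    using integrable_mult_square_integrable by (fastforce simp: mult_ac)
qed

lemma stft_add_scaled:
  assumes "square_integrable f" "square_integrable h" "square_integrable g"
  shows "stft g (\<lambda>t. f t + c * h t) x \<omega> = stft g f x \<omega> + c * stft g h x \<omega>"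
proof -
  have "stft g (\<lambda>t. f t + c * h t) x \<omega> = (LINT t|lborel.
      f t * cnj (g (t - x)) * cis (- 2 * pi * (\<omega> \<bullet> t)) +
      c * (h t * cnj (g (t - x)) * cis (- 2 * pi * (\<omega> \<bullet> t))))"
    unfolding stft_def by (simp add: algebra_simps)
  also have "\<dots> = stft g f x \<omega> + c * stft g h x \<omega>"
    unfolding stft_def
    using stft_integrable[OF assms(1,3)] stft_integrable[OF assms(2,3)]
    by (subst Bochner_Integration.integral_add) auto
  finally show ?thesis .
qed

section \<open>Time-frequency shifts have no square-integrable eigenfunctions\<close>

text \<open>
  The half-spaces \<open>a \<bullet> t \<ge> s + n (a \<bullet> a)\<close> all carry the same mass of \<open>u\<close> and decrease to the empty set.
\<close>

lemma integrable_periodic_AE_zero: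
  fixes u :: "'a::euclidean_space \<Rightarrow> real"
  assumes int: "integrable lborel u" and nonneg: "\<And>t. 0 \<le> u t"
    and a: "a \<noteq> 0" and per: "AE t in lborel. u t = u (t - a)"
  shows "AE t in lborel. u t = 0"
proof -
  have [measurable]: "u \<in> borel_measurable borel"
    using int by (auto dest: borel_measurable_integrable)
  define N where "N = density lborel (\<lambda>t. ennreal (u t))"
  define H where "H s = {t. s \<le> a \<bullet> t}" for s
  have [measurable]: "H s \<in> sets borel" for s
    unfolding H_def by measurable
  have setsN: "sets N = sets borel"
    by (simp add: N_def)
  have N_eq: "emeasure N (H s) = (\<integral>\<^sup>+t. ennreal (u t) * indicator (H s) t \<partial>lborel)" for s
    by (simp add: N_def emeasure_density)
  have finN: "emeasure N (H s) \<noteq> \<infinity>" for s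
  proof -
    have "emeasure N (H s) \<le> (\<integral>\<^sup>+t. ennreal (u t) \<partial>lborel)"
      unfolding N_eq by (intro nn_integral_mono) (auto simp: indicator_def)
    also have "\<dots> < \<infinity>"
      using int nonneg by (simp add: nn_integral_eq_integral)
    finally show ?thesis by simp
  qed
  \<comment> \<open>Replace \<open>u t\<close> by \<open>u (t - a)\<close> using periodicity, then
    substitute \<open>a + t\<close> for \<open>t\<close>; this moves the boundary of the half-space
    back by \<open>a \<bullet> a\<close>.\<close>
  have step: "emeasure N (H (s + a \<bullet> a)) = emeasure N (H s)" for s
  proof -
    have "emeasure N (H (s + a \<bullet> a))
        = (\<integral>\<^sup>+t. ennreal (u (t - a)) * indicator (H (s + a \<bullet> a)) t \<partial>lborel)"
      unfolding N_eq by (intro nn_integral_cong_AE) (use per in eventually_elim, simp)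
    also have "\<dots> = (\<integral>\<^sup>+t. ennreal (u (t - a)) * indicator (H (s + a \<bullet> a)) t
                      \<partial>distr lborel borel ((+) a))"
      by (simp add: lborel_distr_plus)
    also have "\<dots> = (\<integral>\<^sup>+t. ennreal (u t) * indicator (H (s + a \<bullet> a)) (a + t) \<partial>lborel)"
      by (subst nn_integral_distr) auto
    also have "\<dots> = emeasure N (H s)"
      unfolding N_eq
      by (intro nn_integral_cong) (auto simp: H_def indicator_def inner_add_right)
    finally show ?thesis .
  qed
  have steps: "emeasure N (H (s + real n * (a \<bullet> a))) = emeasure N (H s)" for s n
  proof (induction n)
    case (Suc n)
    then show ?case
      using step[of "s + real n * (a \<bullet> a)"] by (simp add: algebra_simps)
  qed simp
  have pos: "a \<bullet> a > 0"
    using a by simp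
  have H_null: "emeasure N (H s) = 0" for s
  proof -
    have "(\<Inter>n. H (s + real n * (a \<bullet> a))) = {}"
    proof (intro equals0I)
      fix t assume t: "t \<in> (\<Inter>n. H (s + real n * (a \<bullet> a)))"
      obtain n where "a \<bullet> t - s < real n * (a \<bullet> a)"
        using reals_Archimedean3[OF pos] by blast
      moreover have "s + real n * (a \<bullet> a) \<le> a \<bullet> t"
        using t by (auto simp: H_def)
      ultimately show False by linarith
    qed
    moreover have "decseq (\<lambda>n. H (s + real n * (a \<bullet> a)))"
    proof (intro decseq_SucI subsetI)
      fix n t assume "t \<in> H (s + real (Suc n) * (a \<bullet> a))"
      moreover have "real n * (a \<bullet> a) \<le> real (Suc n) * (a \<bullet> a)"
        by (intro mult_right_mono) auto
      ultimately show "t \<in> H (s + real n * (a \<bullet> a))"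
        unfolding H_def mem_Collect_eq by linarith
    qed
    ultimately have "(\<lambda>n. emeasure N (H (s + real n * (a \<bullet> a)))) \<longlonglongrightarrow> 0"
      using Lim_emeasure_decseq[of "\<lambda>n. H (s + real n * (a \<bullet> a))" N] finN
      by (simp add: setsN image_subset_iff)
    then show ?thesis
      by (simp add: steps LIMSEQ_const_iff)
  qed
  \<comment> \<open>Countably many of these null half-spaces exhaust the space, so the measure with
    density \<open>u\<close> is zero.\<close>
  have "(\<Union>n. H (- real n)) \<in> null_sets N"
    by (intro null_sets_UN) (auto simp: null_sets_def H_null setsN)
  moreover have "(\<Union>n. H (- real n)) = UNIV"
  proof (intro equalityI subsetI UNIV_I)
    fix t :: 'a
    obtain n where "- (a \<bullet> t) \<le> real n"
      using real_arch_simple by blast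
    then show "t \<in> (\<Union>n. H (- real n))"
      by (auto simp: H_def intro!: exI[of _ n])
  qed
  ultimately have "AE t in lborel. ennreal (u t) = 0"
    by (simp add: N_def null_sets_density_iff)
  then show ?thesis
    by eventually_elim (simp add: nonneg antisym)
qed

text \<open>A nonempty level set of the character is a countable union of parallel hyperplanes
  \<open>b \<bullet> t = b \<bullet> t0 + k\<close> with \<open>k\<close> an integer, each of
  measure zero.\<close>

lemma AE_cis_inner_neq:
  fixes b :: "'a::euclidean_space"
  assumes b: "b \<noteq> 0"
  shows "AE t in lborel. cis (2 * pi * (b \<bullet> t)) \<noteq> c"
proof (cases "\<exists>t0. cis (2 * pi * (b \<bullet> t0)) = c")
  case True
  then obtain t0 where t0: "cis (2 * pi * (b \<bullet> t0)) = c"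
    by blast
  have "{t. b \<bullet> t = b \<bullet> t0 + real_of_int k} \<in> null_sets lborel" for k
  proof -
    have "{t. b \<bullet> t = b \<bullet> t0 + real_of_int k} \<in> null_sets lebesgue"
      using negligible_hyperplane[of b "b \<bullet> t0 + real_of_int k"] b
      by (simp add: negligible_iff_null_sets)
    moreover have "{t. b \<bullet> t = b \<bullet> t0 + real_of_int k} \<in> sets lborel"
      by (simp add: closed_hyperplane borel_closed)
    ultimately show ?thesis
      by (simp add: null_sets_completion_iff)
  qed
  then have "AE t in lborel. t \<notin> (\<Union>k. {t. b \<bullet> t = b \<bullet> t0 + real_of_int k})"
    by (intro AE_not_in null_sets_UN)
  then show ?thesis
  proof eventually_elim
    case (elim t)
    show ?case
    proof
      assume "cis (2 * pi * (b \<bullet> t)) = c"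
      then have "sin (2 * pi * (b \<bullet> t)) = sin (2 * pi * (b \<bullet> t0)) \<and>
          cos (2 * pi * (b \<bullet> t)) = cos (2 * pi * (b \<bullet> t0))"
        using t0 by (auto simp: complex_eq_iff)
      then obtain n :: int where "2 * pi * (b \<bullet> t) = 2 * pi * (b \<bullet> t0) + 2 * pi * n"
        by (auto simp: sin_cos_eq_iff)
      then have "2 * pi * (b \<bullet> t) = 2 * pi * (b \<bullet> t0 + n)"
        by (simp add: distrib_left)
      then have "b \<bullet> t = b \<bullet> t0 + n"
        by simp
      with elim show False
        by blast
    qed
  qed
qed auto

text \<open>Integrating squared moduli forces \<open>G\<close> to have zero norm or
  \<open>|\<alpha>| = |\<beta>|\<close>. In the latter case, if \<open>a \<noteq> 0\<close> then
  \<open>|G|^2\<close> is periodic and integrable, hence null; if \<open>a = 0\<close> then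
  \<open>G\<close> lives on a level set of a nontrivial character. The two-coefficient form also
  covers relations in which one side vanishes.\<close>

lemma time_frequency_shift_no_eigenfunction:
  fixes G :: "real^'d::finite \<Rightarrow> complex"
  assumes G: "square_integrable G" and ab: "a \<noteq> 0 \<or> b \<noteq> 0" and coeff: "\<alpha> \<noteq> 0 \<or> \<beta> \<noteq> 0"
    and eq: "AE t in lborel. \<alpha> * G t = \<beta> * (cis (2 * pi * (b \<bullet> t)) * G (t - a))"
  shows "AE t in lborel. G t = 0"
proof -
  define u where "u t = (cmod (G t))\<^sup>2" for t
  have [measurable]: "G \<in> borel_measurable borel"
    using G by (rule square_integrable_measurable)
  have u_int: "integrable lborel u"
    using G by (simp add: square_integrable_def u_def [abs_def])
  have [measurable]: "u \<in> borel_measurable borel"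
    unfolding u_def [abs_def] by measurable
  have u_nonneg: "0 \<le> u t" for t
    by (simp add: u_def)
  have mods: "AE t in lborel. (cmod \<alpha>)\<^sup>2 * u t = (cmod \<beta>)\<^sup>2 * u (t - a)"
    using eq
  proof eventually_elim
    case (elim t)
    then have "cmod (\<alpha> * G t) = cmod (\<beta> * (cis (2 * pi * (b \<bullet> t)) * G (t - a)))"
      by simp
    then show ?case
      by (simp add: norm_mult u_def flip: power_mult_distrib)
  qed
  have "(LINT t|lborel. u (t - a)) = (LINT t|lborel. u t)"
  proof -
    have "(LINT t|lborel. u (t - a)) = (LINT t|distr lborel borel ((+) a). u (t - a))"
      by (simp add: lborel_distr_plus)
    then show ?thesis
      by (simp add: integral_distr)
  qed
  moreover have "(LINT t|lborel. (cmod \<alpha>)\<^sup>2 * u t) = (LINT t|lborel. (cmod \<beta>)\<^sup>2 * u (t - a))"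
    using mods by (intro integral_cong_AE) auto
  ultimately have "(cmod \<alpha>)\<^sup>2 * (LINT t|lborel. u t) = (cmod \<beta>)\<^sup>2 * (LINT t|lborel. u t)"
    by simp
  then consider "(LINT t|lborel. u t) = 0" | "cmod \<alpha> = cmod \<beta>"
    by auto
  then show ?thesis
  proof cases
    case 1
    then have "AE t in lborel. u t = 0"
      using integral_nonneg_eq_0_iff_AE[OF u_int] u_nonneg by simp
    then show ?thesis
      by (simp add: u_def)
  next
    case 2
    then have nz: "\<alpha> \<noteq> 0" "\<beta> \<noteq> 0"
      using coeff by auto
    show ?thesis
    proof (cases "a = 0")
      case False
      have "AE t in lborel. u t = u (t - a)"
        using mods 2 nz by simp
      then have "AE t in lborel. u t = 0"
        using integrable_periodic_AE_zero[OF u_int u_nonneg False] by simp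
      then show ?thesis
        by (simp add: u_def)
    next
      case True
      with ab have "b \<noteq> 0"
        by simp
      from AE_cis_inner_neq[OF this, of "\<alpha> / \<beta>"] eq show ?thesis
        by eventually_elim (use nz True in \<open>auto simp: field_simps\<close>)
    qed
  qed
qed

section \<open>The transform of a shifted reflected window\<close>

text \<open>This is \<open>\<rho>(a,b) (R g)\<close>, because
  \<open>R g (t - a) = g (a - t)\<close>; taking \<open>a = b = 0\<close> gives \<open>R g\<close>
  itself.\<close>

definition shifted_reflection ::
  "(real^'d::finite \<Rightarrow> complex) \<Rightarrow> real^'d \<Rightarrow> real^'d \<Rightarrow> real^'d \<Rightarrow> complex" where
  "shifted_reflection g a b t = cis (2 * pi * (b \<bullet> t) - pi * (a \<bullet> b)) * g (a - t)"

lemma square_integrable_shifted_reflection: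
  assumes "square_integrable g"
  shows "square_integrable (shifted_reflection g a b)"
proof -
  have "(\<lambda>t. cis (2 * pi * (b \<bullet> t) - pi * (a \<bullet> b))) \<in> borel_measurable borel"
    by (intro borel_measurable_continuous_onI continuous_intros)
  then show ?thesis
    unfolding shifted_reflection_def [abs_def]
    by (intro square_integrable_phase square_integrable_reflect assms) auto
qed

text \<open>
  The substitution \<open>t \<mapsto> x + a - t\<close> turns the integrand, up to phase, into its conjugate.
\<close>

lemma cnj_stft_shifted_reflection:
  fixes g :: "real^'d::finite \<Rightarrow> complex" and a b x \<omega> :: "real^'d"
  assumes g: "square_integrable g"
  defines "P \<equiv> cis (pi * (\<omega> \<bullet> x) + pi * (a \<bullet> \<omega> - b \<bullet> x))"
  shows "cnj (P * stft g (shifted_reflection g a b) x \<omega>)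
       = P * stft g (shifted_reflection g a b) x \<omega>"
proof -
  define F where "F t = P *
    (shifted_reflection g a b t * cnj (g (t - x)) * cis (- 2 * pi * (\<omega> \<bullet> t)))" for t
  have "integrable lborel F"
    unfolding F_def using stft_integrable[OF square_integrable_shifted_reflection[OF g] g]
    by (intro integrable_mult_right)
  then have F_meas: "F \<in> borel_measurable borel"
    by (auto dest: borel_measurable_integrable)
  have F_eq: "F t = cis (pi * (\<omega> \<bullet> x) + pi * (a \<bullet> \<omega> - b \<bullet> x) + 2 * pi * (b \<bullet> t) - pi * (a \<bullet> b)
      - 2 * pi * (\<omega> \<bullet> t)) * (g (a - t) * cnj (g (t - x)))" for t
  proof -
    have "F t = (P * cis (2 * pi * (b \<bullet> t) - pi * (a \<bullet> b)) * cis (- 2 * pi * (\<omega> \<bullet> t)))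
        * (g (a - t) * cnj (g (t - x)))"
      by (simp add: F_def shifted_reflection_def mult_ac)
    then show ?thesis
      by (simp add: P_def cis_mult algebra_simps)
  qed
  \<comment> \<open>The substitution swaps the arguments \<open>a - t\<close> and
    \<open>t - x\<close>, which conjugates the product of the two windows. The constant
    \<open>P\<close> is chosen so that the total phase changes sign.\<close>
  have sym: "F ((x + a) - t) = cnj (F t)" for t
    unfolding F_eq
    by (simp add: cis_cnj algebra_simps inner_commute)
  have "P * stft g (shifted_reflection g a b) x \<omega> = (LINT t|lborel. F t)"
    unfolding stft_def F_def by simp
  moreover have "cnj (LINT t|lborel. F t) = (LINT t|lborel. F t)"
    using integral_lborel_reflect[OF F_meas, of "x + a"] by (simp add: sym)
  ultimately show ?thesis
    by simp
qed

lemma cis_pi_Ints: "n \<in> \<int> \<Longrightarrow> cis (pi * n) \<in> \<real>"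
  by (auto simp: complex_is_Real_iff sin_integer_2pi elim!: Ints_cases)

text \<open>The correcting phase no longer depends on \<open>a\<close> and \<open>b\<close>, so one
  factor makes the transforms of \<open>R g\<close> and of its shift real simultaneously.\<close>

lemma stft_shifted_reflection_real:
  assumes g: "square_integrable g" and "b \<bullet> x - a \<bullet> \<omega> \<in> \<int>"
  shows "cis (pi * (\<omega> \<bullet> x)) * stft g (shifted_reflection g a b) x \<omega> \<in> \<real>"
proof -
  let ?V = "stft g (shifted_reflection g a b) x \<omega>"
  have "cis (pi * (\<omega> \<bullet> x) + pi * (a \<bullet> \<omega> - b \<bullet> x)) * ?V \<in> \<real>"
    using cnj_stft_shifted_reflection[OF g] by (simp add: Reals_cnj_iff)
  \<comment> \<open>By integrality this extra factor is 1 or -1; it cancels the part of the phase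
    that involves \<open>a\<close> and \<open>b\<close>.\<close>
  then have "cis (pi * (b \<bullet> x - a \<bullet> \<omega>)) *
      (cis (pi * (\<omega> \<bullet> x) + pi * (a \<bullet> \<omega> - b \<bullet> x)) * ?V) \<in> \<real>"
    using cis_pi_Ints[OF assms(2)] by (rule Reals_mult[rotated])
  moreover have "cis (pi * (b \<bullet> x - a \<bullet> \<omega>)) * cis (pi * (\<omega> \<bullet> x) + pi * (a \<bullet> \<omega> - b \<bullet> x))
      = cis (pi * (\<omega> \<bullet> x))"
    by (simp add: cis_mult algebra_simps)
  ultimately show ?thesis
    by (simp flip: mult.assoc)
qed

text \<open>The two numbers are complex conjugates of each other.\<close>

lemma cmod_Reals_add_sub_imaginary:
  assumes "p \<in> \<real>" "q \<in> \<real>"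
  shows "cmod (p + \<i> * q) = cmod (p - \<i> * q)"
  using assms by (auto simp: cmod_def elim!: Reals_cases)

section \<open>Sampling sets carrying an integer-valued linear functional\<close>

lemma inner_sum_index:
  fixes v z :: "real^('d::finite + 'd)"
  shows "v \<bullet> z = fst_vec v \<bullet> fst_vec z + snd_vec v \<bullet> snd_vec z"
proof -
  have "v \<bullet> z = (\<Sum>i\<in>UNIV <+> UNIV. v $ i * z $ i)"
    by (simp add: inner_vec_def)
  also have "\<dots> = fst_vec v \<bullet> fst_vec z + snd_vec v \<bullet> snd_vec z"
    by (subst sum.Plus) (auto simp: inner_vec_def fst_vec_def snd_vec_def)
  finally show ?thesis .
qed

lemma stft_phase_retrieval_fails:
  fixes g :: "real^'d::finite \<Rightarrow> complex" and v :: "real^('d + 'd)"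
  assumes g: "square_integrable g" and v: "v \<noteq> 0" and int: "\<And>z. z \<in> \<L> \<Longrightarrow> v \<bullet> z \<in> \<int>"
  shows "\<exists>f1 f2. square_integrable f1 \<and> square_integrable f2 \<and>
           (\<forall>z\<in>\<L>. cmod (stft g f1 (fst_vec z) (snd_vec z)) = cmod (stft g f2 (fst_vec z) (snd_vec z))) \<and>
           \<not> (\<exists>\<nu>::complex. cmod \<nu> = 1 \<and> (AE t in lborel. f1 t = \<nu> * f2 t))"
proof (cases "AE t in lborel. g t = 0")
  case True
  have [measurable]: "g \<in> borel_measurable borel"
    using g by (rule square_integrable_measurable)
  \<comment> \<open>For a null window every transform vanishes, so any nonzero function can be
    paired with 0; the indicator of the unit cube serves.\<close>
  let ?f = "indicator (cbox 0 One) :: real^'d \<Rightarrow> complex"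
  have "integrable lborel (\<lambda>t. (cmod (?f t))\<^sup>2)"
  proof -
    have "(\<lambda>t. (cmod (?f t))\<^sup>2) = indicator (cbox 0 One)"
      by (auto simp: indicator_def)
    then show ?thesis
      by (simp add: emeasure_lborel_cbox_eq)
  qed
  then have f: "square_integrable ?f"
    by (simp add: square_integrable_def)
  have zero: "square_integrable (\<lambda>t::real^'d. 0)"
    by (simp add: square_integrable_def)
  have stft_zero: "stft g h x \<omega> = 0" if "square_integrable h" for h x \<omega>
  proof -
    have "(AE t in lborel. g (- x - (0 - t)) = 0) \<longleftrightarrow> (AE t in lborel. g (- x - t) = 0)"
      by (rule AE_eq_zero_lborel_reflect) measurable
    also have "\<dots> \<longleftrightarrow> (AE t in lborel. g t = 0)"
      by (rule AE_eq_zero_lborel_reflect) measurable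
    finally have "AE t in lborel. g (t - x) = 0"
      using True by simp
    then have "AE t in lborel. h t * cnj (g (t - x)) * cis (- 2 * pi * (\<omega> \<bullet> t)) = 0"
      by eventually_elim simp
    then show ?thesis
      unfolding stft_def by (rule integral_eq_zero_AE)
  qed
  have "\<not> (AE t in lborel. ?f t = 0)"
  proof
    assume "AE t in lborel. ?f t = 0"
    then have "AE t in lborel. t \<notin> cbox 0 (One::real^'d)"
      by eventually_elim (auto simp: indicator_def split: if_splits)
    then have "emeasure lborel (cbox 0 (One::real^'d)) = 0"
      by (subst (asm) AE_iff_measurable[of "cbox 0 One"]) auto
    then show False
      by (auto simp: emeasure_lborel_cbox_eq)
  qed
  then have "\<not> (\<exists>\<nu>::complex. cmod \<nu> = 1 \<and> (AE t in lborel. ?f t = \<nu> * 0))"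
    by simp
  then show ?thesis
    using f zero stft_zero by (intro exI[of _ ?f] exI[of _ "\<lambda>t. 0"]) auto
next
  case False
  \<comment> \<open>The sign makes \<open>b \<bullet> x - a \<bullet> \<omega>\<close> equal to
    \<open>v \<bullet> z\<close> for \<open>z = (x, \<omega>)\<close>.\<close>
  define a where "a = - snd_vec v"
  define b where "b = fst_vec v"
  define G where "G = shifted_reflection g 0 0"
  define H where "H = shifted_reflection g a b"
  have ab: "a \<noteq> 0 \<or> b \<noteq> 0"
    using v inner_sum_index[of v v] unfolding a_def b_def by auto
  have G: "square_integrable G" and H: "square_integrable H"
    unfolding G_def H_def using g by (auto intro: square_integrable_shifted_reflection)
  have cH: "square_integrable (\<lambda>t. c * H t)" if "cmod c = 1" for c
    using that by (intro square_integrable_phase H) auto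
  have G_not_0: "\<not> (AE t in lborel. G t = 0)"
  proof
    assume "AE t in lborel. G t = 0"
    then have "AE t in lborel. g (0 - t) = 0"
      by (simp add: G_def shifted_reflection_def)
    then have "AE t in lborel. g t = 0"
      using AE_eq_zero_lborel_reflect[OF square_integrable_measurable[OF g]] by blast
    with False show False
      by blast
  qed
  have mod_eq: "cmod (stft g (\<lambda>t. G t + \<i> * H t) (fst_vec z) (snd_vec z))
      = cmod (stft g (\<lambda>t. G t + (- \<i>) * H t) (fst_vec z) (snd_vec z))" if z: "z \<in> \<L>" for z
  proof -
    let ?x = "fst_vec z" and ?\<omega> = "snd_vec z"
    define p where "p = cis (pi * (?\<omega> \<bullet> ?x))"
    have cmod_p: "cmod (p * w) = cmod w" for w
      by (simp add: p_def norm_mult)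
    have "b \<bullet> ?x - a \<bullet> ?\<omega> \<in> \<int>"
      using int[OF z] by (simp add: inner_sum_index a_def b_def)
    then have "p * stft g G ?x ?\<omega> \<in> \<real>" "p * stft g H ?x ?\<omega> \<in> \<real>"
      unfolding p_def G_def H_def using g by (auto intro: stft_shifted_reflection_real)
    then have "cmod (p * stft g G ?x ?\<omega> + \<i> * (p * stft g H ?x ?\<omega>))
        = cmod (p * stft g G ?x ?\<omega> - \<i> * (p * stft g H ?x ?\<omega>))"
      by (rule cmod_Reals_add_sub_imaginary)
    then have "cmod (p * (stft g G ?x ?\<omega> + \<i> * stft g H ?x ?\<omega>))
        = cmod (p * (stft g G ?x ?\<omega> + (- \<i>) * stft g H ?x ?\<omega>))"
      by (simp add: algebra_simps)
    then show ?thesis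
      unfolding cmod_p stft_add_scaled[OF G H g] .
  qed
  have not_prop: "\<not> (AE t in lborel. G t + \<i> * H t = \<nu> * (G t + (- \<i>) * H t))" for \<nu>
  proof
    assume "AE t in lborel. G t + \<i> * H t = \<nu> * (G t + (- \<i>) * H t)"
    \<comment> \<open>Proportionality rearranges to
      \<open>(1 - \<nu>) G = - \<i> (1 + \<nu>) H\<close>, and \<open>H\<close> is a constant phase
      times a time-frequency shift of \<open>G\<close>.\<close>
    then have "AE t in lborel. (1 - \<nu>) * G t =
        (- \<i> * (1 + \<nu>) * cis (- pi * (a \<bullet> b))) * (cis (2 * pi * (b \<bullet> t)) * G (t - a))"
    proof eventually_elim
      case (elim t)
      have "H t = cis (- pi * (a \<bullet> b)) * (cis (2 * pi * (b \<bullet> t)) * G (t - a))"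
        by (simp add: H_def G_def shifted_reflection_def cis_mult flip: mult.assoc)
      moreover have "(1 - \<nu>) * G t = - \<i> * (1 + \<nu>) * H t"
        using elim by (simp add: algebra_simps)
      ultimately show ?case
        by (simp add: mult.assoc)
    qed
    \<comment> \<open>The numbers \<open>1 - \<nu>\<close> and \<open>1 + \<nu>\<close> cannot both
      vanish.\<close>
    moreover have "1 - \<nu> \<noteq> 0 \<or> - \<i> * (1 + \<nu>) * cis (- pi * (a \<bullet> b)) \<noteq> 0"
      by (cases "\<nu> = 1") auto
    ultimately have "AE t in lborel. G t = 0"
      using time_frequency_shift_no_eigenfunction[OF G ab] by blast
    with G_not_0 show False ..
  qed
  show ?thesis
  proof (intro exI conjI ballI)
    show "square_integrable (\<lambda>t. G t + \<i> * H t)" "square_integrable (\<lambda>t. G t + (- \<i>) * H t)"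
      by (intro square_integrable_add G cH; simp)+
  qed (use mod_eq not_prop in blast)+
qed

text \<open>Each row of the inverse matrix is a dual lattice vector: paired with
  \<open>M *v k\<close> it returns a coordinate of \<open>k\<close>. It is nonzero because pairing
  with the image of a unit vector gives 1.\<close>

lemma integer_functional_lattice_of:
  fixes M :: "real^'n::finite^'n"
  assumes "invertible M"
  shows "\<exists>v\<noteq>0. \<forall>z\<in>lattice_of M. v \<bullet> z \<in> \<int>"
proof -
  obtain N where N: "N ** M = mat 1" "M ** N = mat 1"
    using assms unfolding invertible_def by blast
  fix i :: 'n
  have row: "row i N \<bullet> (M *v k) = k $ i" for k
  proof -
    have "row i N \<bullet> (M *v k) = (N *v (M *v k)) $ i"
      by (simp add: matrix_vector_mul_component row_def)
    then show ?thesis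
      by (simp add: matrix_vector_mul_assoc N)
  qed
  have "row i N \<noteq> 0"
    using row[of "axis i 1"] by auto
  moreover have "\<forall>z\<in>lattice_of M. row i N \<bullet> z \<in> \<int>"
    by (auto simp: lattice_of_def row)
  ultimately show ?thesis
    by blast
qed

theorem theorem1p1:
  fixes g :: "real^'d \<Rightarrow> complex" and \<L> :: "(real^('d + 'd)) set"
  assumes "(\<exists>S \<Lambda>. symplectic S \<and> is_lattice \<Lambda> \<and>
              \<L> = {S *v join_vec x l | x l. l \<in> \<Lambda>})
         \<or> (\<exists>L S A B. invertible L \<and> symplectic S \<and> invertible A \<and> invertible B \<and>
              L = S ** block_diag A B \<and> \<L> = lattice_of L)"
    and "square_integrable g"
  shows "\<exists>f1 f2. square_integrable f1 \<and> square_integrable f2 \<and>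
           (\<forall>z\<in>\<L>. cmod (stft g f1 (fst_vec z) (snd_vec z)) = cmod (stft g f2 (fst_vec z) (snd_vec z))) \<and>
           \<not> (\<exists>\<nu>::complex. cmod \<nu> = 1 \<and> (AE t in lborel. f1 t = \<nu> * f2 t))"
proof -
  have "\<exists>v\<noteq>0. \<forall>z\<in>\<L>. v \<bullet> z \<in> \<int>"
    using assms(1)
  proof (elim disjE exE conjE)
    fix L :: "real^('d + 'd)^('d + 'd)"
    assume "invertible L" "\<L> = lattice_of L"
    then show ?thesis
      by (simp add: integer_functional_lattice_of)
  next
    fix S \<Lambda>
    assume S: "symplectic S" and \<Lambda>: "is_lattice \<Lambda>" and \<L>: "\<L> = {S *v join_vec x l | x l. l \<in> \<Lambda>}"
    obtain N where N: "N ** S = mat 1"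
      using S unfolding symplectic_def invertible_def by blast
    obtain w where w: "w \<noteq> 0" "\<And>l. l \<in> \<Lambda> \<Longrightarrow> w \<bullet> l \<in> \<int>"
      using \<Lambda> integer_functional_lattice_of unfolding is_lattice_def by blast
    \<comment> \<open>The inverse transpose of \<open>S\<close> applied to \<open>(0, w)\<close>:
      pairing with \<open>S *v y\<close> undoes \<open>S\<close>, and the zero block ignores the
      continuous coordinates. What remains is \<open>w\<close>, an integer-valued functional on the
      lattice.\<close>
    define v where "v = join_vec 0 w v* N"
    have v: "v \<bullet> (S *v y) = w \<bullet> snd_vec y" for y
    proof -
      have "v \<bullet> (S *v y) = join_vec 0 w \<bullet> (N *v (S *v y))"
        by (simp add: v_def dot_lmul_matrix)
      also have "\<dots> = join_vec 0 w \<bullet> y"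
        by (simp add: matrix_vector_mul_assoc N)
      also have "\<dots> = w \<bullet> snd_vec y"
        by (simp add: inner_sum_index) (simp add: join_vec_def fst_vec_def snd_vec_def inner_vec_def)
      finally show ?thesis .
    qed
    have snd_join: "snd_vec (join_vec x l) = l" for x l :: "real^'d"
      by (simp add: snd_vec_def join_vec_def)
    \<comment> \<open>Testing at \<open>y = (0, w)\<close> gives \<open>w \<bullet> w\<close>, which
      is nonzero.\<close>
    have "v \<noteq> 0"
      using v[of "join_vec 0 w"] w(1) by (auto simp: snd_join)
    moreover have "\<forall>z\<in>\<L>. v \<bullet> z \<in> \<int>"
      using w(2) by (auto simp: \<L> v snd_join)
    ultimately show ?thesis
      by blast
  qed
  then show ?thesis
    using stft_phase_retrieval_fails[OF assms(2)] by blast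
qed

end
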